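(* Let $X$ be a Fréchet space and let $(\Omega,\Sigma,\mu)$ be a complete finite measure space. Let $F:\Omega\to ck(X)$ be a multifunction. Then the following statements are equivalent: (i) $F$ admits a measurable by seminorm selector; (ii) $F$ satisfies the property $\mathcal{P}$; (iii) there exist a set of measure zero $\Omega_0\in\Sigma$, a separable subspace $Y\subset X$ and a multifunction $G:\Omega\setminus\Omega_0\to ck(Y)$ that is Effros measurable and such that $G(t)\subset F(t)$ for every $t\in\Omega\setminus\Omega_0$.
   Context: A Fréchet space is a metrizable, complete, locally convex topological vector space $(X,\tau)$. Fix an increasing sequence $(p_i)_{i\in\mathbb{N}}$ of seminorms on $X$ (so $p_i\le p_{i+1}$) defining the topology $\tau$, and the metric $d(x,y)=\sum_{i=1}^{+\infty}\frac{1}{2^i}\frac{p_i(x-y)}{1+p_i(x-y)}$, which generates $\tau$. $ck(X)$ denotes the family of all nonempty convex compact subsets of $X$; similarly $ck(Y)$ for a linear subspace $Y$ of $X$ with the induced topology. $\Sigma^+$ is the family of all $A\in\Sigma$ with $\mu(A)>0$, and for $A\in\Sigma^+$, $\Sigma^+_A=\{B\in\Sigma^+:B\subset A\}$. For a multifunction $F$ on $\Omega$ with values nonempty subsets of $X$ and $U\subset X$, $F^-(U)=\{t\in\Omega:F(t)\cap U\neq\emptyset\}$ (analogously for multifunctions defined on $\Omega\setminus\Omega_0$). A function $f:\Omega\to X$ is a measurable simple function if it takes only finitely many values $x_1,\dots,x_n$ and $f^{-1}(x_j)\in\Sigma$ for each $j$. A function $f:\Omega\to X$ is $p_i$-strongly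 measurable if there exist a sequence of measurable simple functions $f_n^i:\Omega\to X$ and a set $Z_i\in\Sigma$ with $\mu(Z_i)=0$ such that $\lim_{n\to\infty}p_i(f_n^i(t)-f(t))=0$ for all $t\in\Omega\setminus Z_i$. It is measurable by seminorm if it is $p_i$-strongly measurable for each $i\in\mathbb{N}$. $F$ admits a measurable by seminorm selector if there is a measurable by seminorm function $f:\Omega\to X$ with $f(t)\in F(t)$ for every $t\in\Omega$. $F$ satisfies property $\mathcal{P}$ if for each $\varepsilon>0$ and each $A\in\Sigma^+$ there exist $B\in\Sigma^+_A$ and $D\subset X$ with $\operatorname{diam}(D)=\sup\{d(x,y):x,y\in D\}\le\varepsilon$ such that $B\subset F^-(D)$. A multifunction $G$ is Effros measurable if $G^-(\mathcal{O})\in\Sigma$ for every open set $\mathcal{O}$. *)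

theory Defs
  imports "HOL-Analysis.Analysis"
begin

text \<open>
  Metrizable, complete, locally convex real topological vector spaces.  Completeness is with
  respect to the translation-invariant uniformity: a sequence is Cauchy if its differences are
  eventually in every neighbourhood of the origin.  Sequences suffice because of metrizability.
\<close>

definition frechet_space :: "'a::{real_vector,topological_space} itself \<Rightarrow> bool" where
  "frechet_space _ \<longleftrightarrow>
     continuous_on UNIV (\<lambda>(x::'a, y). x + y) \<and>
     continuous_on UNIV (\<lambda>(c::real, x::'a). c *\<^sub>R x) \<and>
     metrizable_space (euclidean :: 'a topology) \<and>
     (\<forall>U::'a set. open U \<and> 0 \<in> U \<longrightarrow> (\<exists>V. open V \<and> convex V \<and> 0 \<in> V \<and> V \<subseteq> U)) \<and>
     (\<forall>s :: nat \<Rightarrow> 'a.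
        (\<forall>U. open U \<and> 0 \<in> U \<longrightarrow> (\<exists>N. \<forall>m\<ge>N. \<forall>n\<ge>N. s m - s n \<in> U)) \<longrightarrow> convergent s)"

definition seminorm :: "('a::real_vector \<Rightarrow> real) \<Rightarrow> bool" where
  "seminorm q \<longleftrightarrow>
     (\<forall>x. 0 \<le> q x) \<and> (\<forall>x y. q (x + y) \<le> q x + q y) \<and> (\<forall>c x. q (c *\<^sub>R x) = \<bar>c\<bar> * q x)"

definition seminorms_define_topology ::
    "(nat \<Rightarrow> 'a::{real_vector,topological_space} \<Rightarrow> real) \<Rightarrow> bool" where
  "seminorms_define_topology p \<longleftrightarrow>
     (open :: 'a set \<Rightarrow> bool) = generate_topology {{y. p i (y - x) < e} | i x e. 0 < e}"

text \<open>
  The seminorms are indexed from \<open>0\<close>: \<open>p i\<close> is the \<open>(i+1)\<close>-st seminorm and gets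
  the weight \<open>1 / 2 ^ (i+1)\<close>.
\<close>

definition seminorm_dist :: "(nat \<Rightarrow> 'a::real_vector \<Rightarrow> real) \<Rightarrow> 'a \<Rightarrow> 'a \<Rightarrow> real" where
  "seminorm_dist p x y = (\<Sum>i. 1 / 2 ^ Suc i * (p i (x - y) / (1 + p i (x - y))))"

text \<open>
  The analogue of \<open>diameter\<close> for \<open>seminorm_dist\<close>.  The supremum is over a bounded set
  of reals, as \<open>seminorm_dist\<close> takes values in \<open>[0, 1]\<close>.
\<close>

definition seminorm_diam :: "(nat \<Rightarrow> 'a::real_vector \<Rightarrow> real) \<Rightarrow> 'a set \<Rightarrow> real" where
  "seminorm_diam p D = (if D = {} then 0 else SUP (x, y)\<in>D \<times> D. seminorm_dist p x y)"

text \<open>Compactness in \<open>top_of_set Y\<close> includes \<open>K \<subseteq> Y\<close>.\<close>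

definition ck :: "'a::{real_vector,topological_space} set \<Rightarrow> 'a set set" where
  "ck Y = {K. K \<noteq> {} \<and> convex K \<and> compactin (top_of_set Y) K}"

definition pos_sets :: "'b measure \<Rightarrow> 'b set set" where
  "pos_sets M = {A \<in> sets M. emeasure M A > 0}"

definition lower_inverse :: "'b set \<Rightarrow> ('b \<Rightarrow> 'a set) \<Rightarrow> 'a set \<Rightarrow> 'b set" where
  "lower_inverse S F U = {t \<in> S. F t \<inter> U \<noteq> {}}"

definition seminorm_strongly_measurable ::
    "('a::real_vector \<Rightarrow> real) \<Rightarrow> 'b measure \<Rightarrow> ('b \<Rightarrow> 'a) \<Rightarrow> bool" where
  "seminorm_strongly_measurable q M f \<longleftrightarrow>
     (\<exists>(s :: nat \<Rightarrow> 'b \<Rightarrow> 'a) Z.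
        (\<forall>n. simple_function M (s n)) \<and> Z \<in> null_sets M \<and>
        (\<forall>t \<in> space M - Z. (\<lambda>n. q (s n t - f t)) \<longlonglongrightarrow> 0))"

definition measurable_by_seminorm ::
    "(nat \<Rightarrow> 'a::real_vector \<Rightarrow> real) \<Rightarrow> 'b measure \<Rightarrow> ('b \<Rightarrow> 'a) \<Rightarrow> bool" where
  "measurable_by_seminorm p M f \<longleftrightarrow> (\<forall>i. seminorm_strongly_measurable (p i) M f)"

definition property_P ::
    "(nat \<Rightarrow> 'a::real_vector \<Rightarrow> real) \<Rightarrow> 'b measure \<Rightarrow> ('b \<Rightarrow> 'a set) \<Rightarrow> bool" where
  "property_P p M F \<longleftrightarrow>
     (\<forall>\<epsilon>>0. \<forall>A \<in> pos_sets M. \<exists>B \<in> pos_sets M. \<exists>D.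
        B \<subseteq> A \<and> seminorm_diam p D \<le> \<epsilon> \<and> B \<subseteq> lower_inverse (space M) F D)"

text \<open>
  Effros measurability of a multifunction with domain \<open>S\<close> and values in the space
  \<open>T\<close>.  A multifunction is a function on the whole type of which only the values on its
  domain matter.
\<close>

definition effros_measurable ::
    "'b measure \<Rightarrow> 'b set \<Rightarrow> 'a topology \<Rightarrow> ('b \<Rightarrow> 'a set) \<Rightarrow> bool" where
  "effros_measurable M S T G \<longleftrightarrow> (\<forall>U. openin T U \<longrightarrow> lower_inverse S G U \<in> sets M)"

end

theory Submission
  imports Defs
begin

text \<open>
  By exhaustion, property \<open>\<P>\<close> yields countably valued measurable functions \<open>f\<^sub>n\<close> such that
  almost every \<open>F t\<close> has a point \<open>2\<^sup>-\<^sup>n\<close>-close to \<open>f\<^sub>n t\<close> in \<open>p n\<close>.  As \<open>F t\<close> is compact, the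
  sequence \<open>f\<^sub>n t\<close> clusters at points of \<open>F t\<close>, and a least-index choice among the countably many
  values selects a cluster point measurably.  A selector \<open>f\<close> takes almost all its values in a
  separable subspace, so \<open>G t = {f t}\<close> gives (iii).  Conversely, countably many small balls cover
  that subspace, so on every set of positive measure one of them is hit by \<open>G\<close> with positive
  measure, which is property \<open>\<P>\<close>.
\<close>

text \<open>The total mass bounds the measures of countable unions of \<open>Q\<close>-sets, and
  merging a maximizing sequence of families attains their supremum. A remainder of positive measure
  would contain a further \<open>Q\<close>-set, and adding it would exceed that supremum.\<close>

lemma (in finite_measure) countable_exhaustion:
  assumes empty: "Q {}"
    and pos: "\<And>A. A \<in> sets M \<Longrightarrow> 0 < emeasure M A \<Longrightarrow>
      \<exists>B\<in>sets M. B \<subseteq> A \<and> 0 < emeasure M B \<and> Q B"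
  shows "\<exists>B :: nat \<Rightarrow> 'a set. (\<forall>n. B n \<in> sets M \<and> Q (B n)) \<and> space M - (\<Union>n. B n) \<in> null_sets M"
proof -
  define \<B> where "\<B> = {B :: nat \<Rightarrow> 'a set. \<forall>n. B n \<in> sets M \<and> Q (B n)}"
  define m where "m B = measure M (\<Union>n. B n)" for B :: "nat \<Rightarrow> 'a set"
  have bdd: "bdd_above (m ` \<B>)"
    by (auto simp: bdd_above_def m_def intro: bounded_measure)
  have ne: "\<B> \<noteq> {}"
    using empty by (auto simp: \<B>_def intro!: exI[of _ "\<lambda>_. {}"])
  have "\<exists>B\<in>\<B>. Sup (m ` \<B>) - 1 / real (Suc k) < m B" for k
    using less_cSUP_iff[OF ne bdd, of "Sup (m ` \<B>) - 1 / real (Suc k)"] by simp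
  then obtain B where B: "\<And>k. B k \<in> \<B>" "\<And>k. Sup (m ` \<B>) - 1 / real (Suc k) < m (B k)"
    unfolding Bex_def by metis
  \<comment> \<open>Pairing merges the maximizing sequence of families into one family whose union
    contains each of theirs.\<close>
  define C where "C n = (case prod_decode n of (k, l) \<Rightarrow> B k l)" for n
  have C: "C \<in> \<B>"
    using B(1) by (auto simp: C_def \<B>_def split: prod.split)
  have meas: "(\<Union>n. D n) \<in> sets M" if "D \<in> \<B>" for D
    using that by (auto simp: \<B>_def)
  have "B k l \<subseteq> (\<Union>n. C n)" for k l
  proof -
    have "B k l = C (prod_encode (k, l))"
      by (simp add: C_def)
    then show ?thesis
      by blast
  qed
  then have "m (B k) \<le> m C" for k
    unfolding m_def by (intro finite_measure_mono meas C) auto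
  then have "Sup (m ` \<B>) - 1 / real (Suc k) \<le> m C" for k
    using B(2)[of k] by (meson less_eq_real_def order_less_le_trans)
  note near_Sup = this
  have max: "Sup (m ` \<B>) \<le> m C"
  proof (rule field_le_epsilon)
    fix e :: real assume "0 < e"
    then obtain k where "1 / real (Suc k) < e"
      by (rule nat_approx_posE)
    then show "Sup (m ` \<B>) \<le> m C + e"
      using near_Sup[of k] by linarith
  qed
  have "\<not> 0 < emeasure M (space M - (\<Union>n. C n))"
  proof
    assume "0 < emeasure M (space M - (\<Union>n. C n))"
    then obtain A where A: "A \<in> sets M" "A \<subseteq> space M - (\<Union>n. C n)" "0 < emeasure M A" "Q A"
      using pos[of "space M - (\<Union>n. C n)"] meas[OF C] by blast
    define D where "D = case_nat A C"
    have D: "D \<in> \<B>"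
      using A C by (auto simp: D_def \<B>_def split: nat.split)
    have "(\<Union>n. D n) = D 0 \<union> (\<Union>n. D (Suc n))"
      by (subst UNIV_nat_eq) simp
    then have "(\<Union>n. D n) = A \<union> (\<Union>n. C n)"
      by (simp add: D_def)
    then have "m D = measure M A + m C"
      unfolding m_def using A meas[OF C] by (simp only:) (rule finite_measure_Union; auto)
    moreover have "0 < measure M A"
      using A(3) by (simp add: measure_def enn2real_positive_iff less_top[symmetric])
    moreover have "m D \<le> Sup (m ` \<B>)"
      using D bdd by (intro cSUP_upper)
    ultimately show False
      using max by simp
  qed
  then have "space M - (\<Union>n. C n) \<in> null_sets M"
    using meas[OF C] by (auto simp: null_sets_def)
  then show ?thesis
    using C by (auto simp: \<B>_def)
qed

section \<open>Seminorms, topology and metric\<close>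

locale increasing_seminorms =
  fixes p :: "nat \<Rightarrow> 'a::{real_vector,topological_space} \<Rightarrow> real"
  assumes seminorm_p: "seminorm (p i)"
    and p_le_Suc: "p i x \<le> p (Suc i) x"
    and topology_p: "seminorms_define_topology p"
begin

lemma p_nonneg [simp]: "0 \<le> p i x"
  and p_add: "p i (x + y) \<le> p i x + p i y"
  and p_scale: "p i (c *\<^sub>R x) = \<bar>c\<bar> * p i x"
  using seminorm_p[of i] by (auto simp: seminorm_def)

lemma p_zero [simp]: "p i 0 = 0"
  using p_scale[of i 0 0] by simp

lemma p_commute: "p i (x - y) = p i (y - x)"
  using p_scale[of i "-1" "x - y"] by simp

lemma p_triangle: "p i (x - z) \<le> p i (x - y) + p i (y - z)"
  using p_add[of i "x - y" "y - z"] by simp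

lemma p_mono: "i \<le> j \<Longrightarrow> p i x \<le> p j x"
  by (rule lift_Suc_mono_le[of "\<lambda>i. p i x"]) (use p_le_Suc in auto)

lemma open_p_ball:
  assumes "0 < e"
  shows "open {y. p i (y - x) < e}"
proof -
  have "generate_topology {{y. p i (y - x) < e} | i x e. 0 < e} {y. p i (y - x) < e}"
    using assms by (intro generate_topology.Basis) blast
  then show ?thesis
    using topology_p by (simp add: seminorms_define_topology_def)
qed

text \<open>By monotonicity the seminorm with the larger index controls both factors of an
  intersection, so one seminorm suffices at each point. A generating ball with another centre is
  handled by shrinking the radius to the slack in the triangle inequality.\<close>

lemma open_contains_p_ball:
  assumes "open U" "x \<in> U"
  shows "\<exists>i e. 0 < e \<and> {y. p i (y - x) < e} \<subseteq> U"
proof -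
  have "generate_topology {{y. p i (y - x) < e} | i x e. 0 < e} U"
    using topology_p assms(1) by (simp add: seminorms_define_topology_def)
  then show ?thesis
    using assms(2)
  proof induction
    case UNIV
    show ?case by (auto intro: exI[of _ "1::real"])
  next
    case (Int U V)
    then obtain i e j d where *: "0 < e" "{y. p i (y - x) < e} \<subseteq> U"
        "0 < d" "{y. p j (y - x) < d} \<subseteq> V"
      by blast
    have "p i (y - x) \<le> p (max i j) (y - x)" "p j (y - x) \<le> p (max i j) (y - x)" for y
      by (auto intro: p_mono)
    then have "{y. p (max i j) (y - x) < min e d} \<subseteq> U \<inter> V"
      using * by (smt (verit) Int_iff mem_Collect_eq subset_iff)
    then show ?case
      using * by (metis min_less_iff_conj)
  next
    case (UN K)
    then show ?case by blast
  next
    case (Basis S)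
    then obtain i z e where S: "0 < e" "S = {y. p i (y - z) < e}"
      by blast
    have "{y. p i (y - x) < e - p i (x - z)} \<subseteq> S"
      using p_triangle[of i _ z x] S by (smt (verit) Collect_mono_iff)
    then show ?case
      using S Basis.prems by (intro exI[of _ i] exI[of _ "e - p i (x - z)"]) auto
  qed
qed

lemma open_p_iff: "open U \<longleftrightarrow> (\<forall>x\<in>U. \<exists>i e. 0 < e \<and> {y. p i (y - x) < e} \<subseteq> U)"
proof
  show "open U" if *: "\<forall>x\<in>U. \<exists>i e. 0 < e \<and> {y. p i (y - x) < e} \<subseteq> U"
  proof (rule topological_space_class.openI)
    fix x assume "x \<in> U"
    then obtain i e where "0 < e" "{y. p i (y - x) < e} \<subseteq> U"
      using * by blast
    then show "\<exists>T. open T \<and> x \<in> T \<and> T \<subseteq> U"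
      by (intro exI[of _ "{y. p i (y - x) < e}"]) (auto intro: open_p_ball)
  qed
qed (use open_contains_p_ball in blast)

lemma closed_p_cball: "closed {y. p i (y - x) \<le> e}"
  unfolding closed_def open_p_iff
proof
  fix z assume "z \<in> - {y. p i (y - x) \<le> e}"
  then have z: "e < p i (z - x)" by auto
  have "e < p i (y - x)" if "p i (y - z) < p i (z - x) - e" for y
    using that p_triangle[of i z x y] p_commute[of i y z] by linarith
  then have "{y. p i (y - z) < p i (z - x) - e} \<subseteq> - {y. p i (y - x) \<le> e}"
    by force
  then show "\<exists>j d. 0 < d \<and> {y. p j (y - z) < d} \<subseteq> - {y. p i (y - x) \<le> e}"
    using z by (intro exI[of _ i] exI[of _ "p i (z - x) - e"]) simp
qed

section \<open>Comparison of the metric with the seminorms\<close>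

lemma seminorm_dist_term_le: "1 / 2 ^ Suc i * (p i x / (1 + p i x)) \<le> (1 / 2) ^ Suc i"
proof -
  have "p i x / (1 + p i x) \<le> 1"
    by (subst divide_le_eq_1) (auto simp: add_pos_nonneg)
  then have "1 / 2 ^ Suc i * (p i x / (1 + p i x)) \<le> 1 / 2 ^ Suc i * 1"
    by (rule mult_left_mono) simp
  then show ?thesis
    by (simp only: power_one_over mult_1_right)
qed

lemma summable_seminorm_dist:
  "summable (\<lambda>i. 1 / 2 ^ Suc i * (p i (x - y) / (1 + p i (x - y))))"
proof (rule summable_comparison_test')
  show "summable (\<lambda>i. (1 / 2 :: real) ^ Suc i)"
    using power_half_series by (rule sums_summable)
  show "norm (1 / 2 ^ Suc i * (p i (x - y) / (1 + p i (x - y)))) \<le> (1 / 2) ^ Suc i" for i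
    using seminorm_dist_term_le[of i "x - y"] by (simp add: add_nonneg_nonneg)
qed

lemma seminorm_dist_ge: "1 / 2 ^ Suc i * (p i (x - y) / (1 + p i (x - y))) \<le> seminorm_dist p x y"
  using sum_le_suminf[OF summable_seminorm_dist, of "{i}" x y]
  by (simp add: seminorm_dist_def add_nonneg_nonneg)

lemma seminorm_dist_le_1: "seminorm_dist p x y \<le> 1"
  unfolding seminorm_dist_def
  using suminf_le[OF seminorm_dist_term_le summable_seminorm_dist sums_summable[OF power_half_series]]
    sums_unique[OF power_half_series] by (simp only:)

text \<open>Split the series at \<open>i\<close>: by monotonicity the earlier terms are at most
  their weights times \<open>p i (x - y)\<close>, with weights summing to at most 1, and the tail is
  at most the sum of its weights.\<close>

lemma seminorm_dist_le: "seminorm_dist p x y \<le> p i (x - y) + (1 / 2) ^ i"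
proof -
  let ?d = "\<lambda>k. 1 / 2 ^ Suc k * (p k (x - y) / (1 + p k (x - y)))"
  let ?h = "\<lambda>k. (1 / 2 :: real) ^ Suc k"
  have h: "summable ?h" "suminf ?h = 1"
    using power_half_series by (auto simp: sums_iff)
  have head: "?d k \<le> ?h k * p i (x - y)" if "k < i" for k
  proof -
    have "p k (x - y) / (1 + p k (x - y)) \<le> p k (x - y)"
      using mult_right_mono[of 1 "1 + p k (x - y)" "p k (x - y)"]
      by (subst pos_divide_le_eq) (auto simp: add_pos_nonneg mult.commute)
    also have "\<dots> \<le> p i (x - y)"
      using that by (intro p_mono) auto
    finally have "?h k * (p k (x - y) / (1 + p k (x - y))) \<le> ?h k * p i (x - y)"
      by (rule mult_left_mono) simp
    then show ?thesis
      by (simp only: power_one_over)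
  qed
  have "seminorm_dist p x y = (\<Sum>k. ?d (k + i)) + sum ?d {..<i}"
    unfolding seminorm_dist_def by (rule suminf_split_initial_segment[OF summable_seminorm_dist])
  also have "(\<Sum>k. ?d (k + i)) \<le> (\<Sum>k. ?h (k + i))"
    using summable_ignore_initial_segment[OF h(1)]
      summable_ignore_initial_segment[OF summable_seminorm_dist]
    by (intro suminf_le seminorm_dist_term_le)
  also have "(\<Sum>k. ?h (k + i)) = (\<Sum>k. (1 / 2) ^ i * ?h k)"
    by (simp add: power_add mult_ac)
  also have "\<dots> = (1 / 2) ^ i"
    using suminf_mult[OF h(1), of "(1 / 2) ^ i"] h(2) by simp
  also have "sum ?d {..<i} \<le> (\<Sum>k<i. ?h k * p i (x - y))"
    using head by (intro sum_mono) auto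
  also have "\<dots> = sum ?h {..<i} * p i (x - y)"
    by (simp add: sum_distrib_right)
  also have "\<dots> \<le> 1 * p i (x - y)"
    using sum_le_suminf[OF h(1), of "{..<i}"] h(2) by (intro mult_right_mono) auto
  finally show ?thesis by simp
qed

lemma seminorm_dist_le_diam:
  assumes "x \<in> D" "y \<in> D"
  shows "seminorm_dist p x y \<le> seminorm_diam p D"
proof -
  have "bdd_above ((\<lambda>(x, y). seminorm_dist p x y) ` (D \<times> D))"
    using seminorm_dist_le_1 by (auto simp: bdd_above_def)
  from cSUP_upper[OF _ this, of "(x, y)"] show ?thesis
    using assms by (auto simp: seminorm_diam_def)
qed

lemma seminorm_diam_le:
  assumes "0 \<le> e" "\<And>x y. x \<in> D \<Longrightarrow> y \<in> D \<Longrightarrow> seminorm_dist p x y \<le> e"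
  shows "seminorm_diam p D \<le> e"
  using assms by (auto simp: seminorm_diam_def intro!: cSUP_least)

text \<open>The threshold is the value of the \<open>i\<close>-th term of the metric at seminorm
  \<open>e\<close>. Since s / (1 + s) increases with s, a bound on that term inverts to a bound on
  the seminorm.\<close>

lemma small_diam_imp_p_le:
  assumes "0 < e"
  shows "\<exists>d>0. \<forall>D. seminorm_diam p D \<le> d \<longrightarrow> (\<forall>x\<in>D. \<forall>y\<in>D. p i (x - y) \<le> e)"
proof (intro exI[of _ "1 / 2 ^ Suc i * (e / (1 + e))"] conjI allI impI ballI)
  show "0 < 1 / 2 ^ Suc i * (e / (1 + e))"
    using assms by simp
  fix D x y
  assume "seminorm_diam p D \<le> 1 / 2 ^ Suc i * (e / (1 + e))" "x \<in> D" "y \<in> D"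
  then have "1 / 2 ^ Suc i * (p i (x - y) / (1 + p i (x - y))) \<le> 1 / 2 ^ Suc i * (e / (1 + e))"
    using seminorm_dist_ge seminorm_dist_le_diam order_trans by meson
  then have "p i (x - y) / (1 + p i (x - y)) \<le> e / (1 + e)"
    by (subst (asm) mult_le_cancel_left_pos) auto
  moreover have "0 < 1 + p i (x - y)" "0 < 1 + e"
    using assms by (auto simp: add_pos_nonneg)
  ultimately show "p i (x - y) \<le> e"
    by (simp add: pos_divide_le_eq pos_le_divide_eq algebra_simps)
qed

text \<open>Choose \<open>i\<close> so that the tail of the metric costs less than e/2; two points
  of a \<open>p i\<close>-ball of radius e/4 contribute less than the other e/2, whatever the
  centre.\<close>

lemma small_ball_diam_le:
  assumes "0 < e"
  shows "\<exists>i d. 0 < d \<and> (\<forall>x. seminorm_diam p {y. p i (y - x) < d} \<le> e)"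
proof -
  obtain i where i: "(1 / 2 :: real) ^ i < e / 2"
    using real_arch_pow_inv[of "e / 2" "1 / 2"] assms by auto
  have "seminorm_diam p {y. p i (y - x) < e / 4} \<le> e" for x
  proof (rule seminorm_diam_le)
    fix y z assume "y \<in> {y. p i (y - x) < e / 4}" "z \<in> {y. p i (y - x) < e / 4}"
    then show "seminorm_dist p y z \<le> e"
      using seminorm_dist_le[of y z i] p_triangle[of i y z x] p_commute[of i x z] i by simp
  qed (use assms in simp)
  then show ?thesis
    using assms by (intro exI[of _ i] exI[of _ "e / 4"]) auto
qed

text \<open>The functions \<open>d j\<close> agree with the distances only off \<open>Z\<close>, so
  globally measurable versions, such as limits that are controlled only almost everywhere, can be
  supplied.\<close>

lemma seminorm_strongly_measurableI:
  fixes c :: "nat \<Rightarrow> 'a"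
  assumes Z: "Z \<in> null_sets M"
    and d [measurable]: "\<And>j. d j \<in> borel_measurable M"
    and d_eq: "\<And>j t. t \<in> space M - Z \<Longrightarrow> p i (c j - f t) = d j t"
    and dense: "\<And>e t. t \<in> space M - Z \<Longrightarrow> 0 < e \<Longrightarrow> \<exists>j. p i (c j - f t) < e"
  shows "seminorm_strongly_measurable (p i) M f"
proof -
  \<comment> \<open>Approximate \<open>f t\<close> by the nearest of \<open>c 0, \<dots>, c n\<close>.\<close>
  define J where "J n t = (LEAST j. j \<le> n \<and> (\<forall>k\<le>n. d j t \<le> d k t))" for n :: nat and t
  have [measurable]: "J n \<in> measurable M (count_space UNIV)" for n
    unfolding J_def by measurable
  have "\<exists>j. j \<le> n \<and> (\<forall>k\<le>n. d j t \<le> d k t)" for n :: nat and t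
    using ex_is_arg_min_if_finite[of "{..n}" "\<lambda>j. d j t"]
    by (auto simp: is_arg_min_linorder)
  then have J: "J n t \<le> n" "k \<le> n \<Longrightarrow> d (J n t) t \<le> d k t" for n k :: nat and t
    using LeastI_ex[of "\<lambda>j. j \<le> n \<and> (\<forall>k\<le>n. d j t \<le> d k t)"] unfolding J_def by blast+
  have "simple_function M (\<lambda>t. c (J n t))" for n
    unfolding simple_function_def
  proof
    have "(\<lambda>t. c (J n t)) ` space M \<subseteq> c ` {..n}"
      using J(1) by auto
    then show "finite ((\<lambda>t. c (J n t)) ` space M)"
      by (rule finite_subset) simp
    have "(\<lambda>t. c (J n t)) -` {x} \<inter> space M = J n -` (c -` {x}) \<inter> space M" for x
      by auto
    then show "\<forall>x\<in>(\<lambda>t. c (J n t)) ` space M. (\<lambda>t. c (J n t)) -` {x} \<inter> space M \<in> sets M"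
      by (metis UNIV_I \<open>\<And>n. J n \<in> measurable M (count_space UNIV)\<close> measurable_sets sets_count_space Pow_UNIV)
  qed
  moreover have "(\<lambda>n. p i (c (J n t) - f t)) \<longlonglongrightarrow> 0" if t: "t \<in> space M - Z" for t
  proof (rule LIMSEQ_I)
    fix e :: real assume "0 < e"
    then obtain j where "p i (c j - f t) < e"
      using dense t by blast
    then have "p i (c (J n t) - f t) < e" if "j \<le> n" for n
      using J(2)[OF that, of t] by (simp add: d_eq[OF t])
    then show "\<exists>no. \<forall>n\<ge>no. norm (p i (c (J n t) - f t) - 0) < e"
      by auto
  qed
  ultimately show ?thesis
    unfolding seminorm_strongly_measurable_def using Z
    by (intro exI[of _ "\<lambda>n t. c (J n t)"] exI[of _ Z]) blast
qed

end

section \<open>Measurable selectors\<close>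

text \<open>
  The points \<open>c (x n)\<close> with \<open>n\<close> in the \<open>k\<close>-th index set stay infinitely often within
  \<open>2\<^sup>-\<^sup>k\<close> of one \<open>c j\<close>.  Taking the least such \<open>j\<close> makes the choice of a cluster
  point of \<open>c (x n)\<close> depend measurably on \<open>x\<close>.
\<close>

primrec cluster_indices ::
    "(nat \<Rightarrow> 'a::real_vector \<Rightarrow> real) \<Rightarrow> (nat \<Rightarrow> 'a) \<Rightarrow> (nat \<Rightarrow> nat) \<Rightarrow> nat \<Rightarrow> nat set" where
  "cluster_indices p c x 0 = UNIV"
| "cluster_indices p c x (Suc k) =
    {n \<in> cluster_indices p c x k.
       p k (c (x n) - c (LEAST j. infinite {n \<in> cluster_indices p c x k.
         p k (c (x n) - c j) < (1 / 2) ^ k})) < (1 / 2) ^ k}"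

definition cluster_centre ::
    "(nat \<Rightarrow> 'a::real_vector \<Rightarrow> real) \<Rightarrow> (nat \<Rightarrow> 'a) \<Rightarrow> (nat \<Rightarrow> nat) \<Rightarrow> nat \<Rightarrow> nat" where
  "cluster_centre p c x k =
    (LEAST j. infinite {n \<in> cluster_indices p c x k. p k (c (x n) - c j) < (1 / 2) ^ k})"

lemma cluster_indices_Suc:
  "cluster_indices p c x (Suc k) =
    {n \<in> cluster_indices p c x k. p k (c (x n) - c (cluster_centre p c x k)) < (1 / 2) ^ k}"
  by (simp add: cluster_centre_def)

text \<open>For sets of naturals, being infinite is a countable combination of membership
  conditions, and a least index is measurable. So measurability passes from the \<open>k\<close>-th
  index set to the \<open>k\<close>-th centre, and from both to the next index set.\<close>

lemma measurable_cluster: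
  fixes \<phi> :: "nat \<Rightarrow> 'b \<Rightarrow> nat"
  assumes \<phi> [measurable]: "\<And>n. \<phi> n \<in> measurable M (count_space UNIV)"
  shows measurable_cluster_indices:
      "Measurable.pred M (\<lambda>t. n \<in> cluster_indices p c (\<lambda>n. \<phi> n t) k)" (is "?I k n")
    and measurable_cluster_centre:
      "(\<lambda>t. cluster_centre p c (\<lambda>n. \<phi> n t) k) \<in> measurable M (count_space UNIV)" (is "?C k")
proof -
  have C: "?C k" if [measurable]: "\<And>n. ?I k n" for k
    unfolding cluster_centre_def infinite_nat_iff_unbounded_le mem_Collect_eq
    by measurable
  have I: "?I k n" for k n
  proof (induction k arbitrary: n)
    case (Suc k)
    note [measurable] = Suc C[OF Suc]
    have "(\<lambda>t. p k (c (\<phi> n t) - c (cluster_centre p c (\<lambda>n. \<phi> n t) k))) \<in> borel_measurable M"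
      \<comment> \<open>The centre takes countably many values, so it may be frozen at
        \<open>j\<close>.\<close>
      by (rule measurable_compose_countable[of "\<lambda>j t. p k (c (\<phi> n t) - c j)"]) measurable
    note [measurable] = this
    show ?case
      unfolding cluster_indices_Suc mem_Collect_eq by measurable
  qed simp
  show "?I k n" "?C k"
    using I C[OF I] by auto
qed

context increasing_seminorms
begin

text \<open>The centres depend on \<open>x\<close> alone; the points \<open>y n\<close> only prove
  that they work. Compactness traps infinitely many \<open>y n\<close> in one small ball, which
  keeps every index set infinite. Late members of deep index sets then show that finitely many of
  the closed sets \<open>E k\<close> meet in \<open>K\<close>, and the finite intersection property
  yields the limit.\<close>

lemma ex_cluster_limit:
  fixes c y :: "nat \<Rightarrow> 'a" and x :: "nat \<Rightarrow> nat"
  assumes K: "compact K" and y: "\<And>n. y n \<in> K"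
    and approx: "\<And>n. p n (y n - c (x n)) \<le> (1 / 2) ^ n"
  shows "\<exists>z\<in>K. \<forall>k. p k (z - c (cluster_centre p c x k)) \<le> 2 * (1 / 2) ^ k"
proof -
  have approx': "p k (y n - c (x n)) \<le> (1 / 2) ^ n" if "k \<le> n" for k n
    using approx[of n] p_mono[OF that, of "y n - c (x n)"] by simp
  have inf: "infinite (cluster_indices p c x k)" for k
  proof (induction k)
    case (Suc k)
    define e :: real where "e = (1 / 2) ^ k"
    have e: "0 < e" by (simp add: e_def)
    \<comment> \<open>The offset 3 makes each approximation error at most e/8. Two errors and two
      radii e/4 add up to less than \<open>e\<close>.\<close>
    define N where "N = cluster_indices p c x k \<inter> {k + 3..}"
    have "infinite N"
      using Suc unfolding N_def infinite_nat_iff_unbounded_le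
      by (metis Int_iff atLeast_iff max.bounded_iff)
    have cover: "K \<subseteq> (\<Union>z\<in>K. {y. p k (y - z) < e / 4})"
      using e by auto
    have "open {y. p k (y - z) < e / 4}" for z
      using e by (intro open_p_ball) simp
    from compactE_image[OF K this cover]
    obtain C where C: "C \<subseteq> K" "finite C" "K \<subseteq> (\<Union>z\<in>C. {y. p k (y - z) < e / 4})"
      by blast
    then have "\<exists>z\<in>C. p k (y n - z) < e / 4" for n
      using y by blast
    then obtain z where z: "\<And>n. z n \<in> C" "\<And>n. p k (y n - z n) < e / 4"
      by metis
    have "finite (z ` N)"
      using z(1) C(2) by (meson finite_subset image_subsetI)
    then obtain n0 where n0: "n0 \<in> N" "infinite {n \<in> N. z n = z n0}"
      using pigeonhole_infinite[OF \<open>infinite N\<close>] by blast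
    have near: "p k (y n - c (x n)) \<le> e / 8" if "n \<in> N" for n
    proof -
      have "k + 3 \<le> n"
        using that by (simp add: N_def)
      then have "(1 / 2 :: real) ^ n \<le> (1 / 2) ^ (k + 3)"
        by (intro power_decreasing) auto
      then show ?thesis
        using approx'[of k n] \<open>k + 3 \<le> n\<close> by (simp add: e_def power_add power3_eq_cube)
    qed
    have "p k (c (x n) - c (x n0)) < e" if "n \<in> N" "z n = z n0" for n
      using near[OF that(1)] near[OF n0(1)] z(2)[of n] z(2)[of n0] that(2) e
        p_triangle[of k "c (x n)" "c (x n0)" "z n"] p_triangle[of k "c (x n)" "z n" "y n"]
        p_triangle[of k "z n" "c (x n0)" "y n0"] p_commute[of k "c (x n)" "y n"]
        p_commute[of k "z n" "y n0"] by simp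
    then have "{n \<in> N. z n = z n0} \<subseteq>
        {n \<in> cluster_indices p c x k. p k (c (x n) - c (x n0)) < (1 / 2) ^ k}"
      by (auto simp: N_def e_def)
    \<comment> \<open>Hence \<open>x n0\<close> is an admissible value of \<open>j\<close>, so the
      least one has the infinite set too.\<close>
    then have "infinite {n \<in> cluster_indices p c x k. p k (c (x n) - c (x n0)) < (1 / 2) ^ k}"
      using n0(2) infinite_super by blast
    then show ?case
      unfolding cluster_indices_Suc cluster_centre_def by (rule LeastI)
  qed simp
  have anti: "cluster_indices p c x j \<subseteq> cluster_indices p c x i" if "i \<le> j" for i j
    using that by (induction rule: dec_induct) auto
  \<comment> \<open>The factor 2 covers the step from \<open>y n\<close> to \<open>c (x n)\<close>
    and the step from there to the centre.\<close>
  define E where "E k = {z. p k (z - c (cluster_centre p c x k)) \<le> 2 * (1 / 2) ^ k}" for k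
  have "K \<inter> (\<Inter>k\<in>UNIV. E k) \<noteq> {}"
  proof (rule compact_imp_fip_image[OF K])
    show "closed (E k)" for k
      unfolding E_def by (rule closed_p_cball)
    fix I :: "nat set" assume "finite I"
    then obtain m where m: "\<And>k. k \<in> I \<Longrightarrow> k \<le> m"
      by (auto simp: finite_nat_set_iff_bounded_le)
    \<comment> \<open>Membership at level \<open>Suc k\<close> encodes closeness to the
      \<open>k\<close>-th centre, hence \<open>Suc m\<close>; the index sets are nested, so this
      \<open>n\<close> serves all \<open>k\<close> in \<open>I\<close>.\<close>
    obtain n where n: "n \<in> cluster_indices p c x (Suc m)" "m \<le> n"
      using inf[of "Suc m"] unfolding infinite_nat_iff_unbounded_le by blast
    have "y n \<in> E k" if "k \<in> I" for k
    proof -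
      have "k \<le> m" using m that by simp
      then have "n \<in> cluster_indices p c x (Suc k)"
        using anti[of "Suc k" "Suc m"] n(1) by auto
      then have "p k (c (x n) - c (cluster_centre p c x k)) < (1 / 2) ^ k"
        by (simp only: cluster_indices_Suc mem_Collect_eq)
      moreover have "p k (y n - c (x n)) \<le> (1 / 2) ^ k"
        using \<open>k \<le> m\<close> n(2) by (intro order_trans[OF approx' power_decreasing]) auto
      ultimately show ?thesis
        using p_triangle[of k "y n" "c (cluster_centre p c x k)" "c (x n)"] by (simp add: E_def)
    qed
    then show "K \<inter> (\<Inter>k\<in>I. E k) \<noteq> {}"
      using y by blast
  qed
  then show "\<exists>z\<in>K. \<forall>k. p k (z - c (cluster_centre p c x k)) \<le> 2 * (1 / 2) ^ k"
    by (auto simp: E_def)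
qed

text \<open>The limits are chosen pointwise. Measurability is recovered from distances: those from
  \<open>c j\<close> to \<open>f t\<close> are limits of the measurable distances from
  \<open>c j\<close> to the centres, and the centres come arbitrarily close to
  \<open>f t\<close>.\<close>

lemma ex_measurable_selector_of_approximations:
  fixes c :: "nat \<Rightarrow> 'a" and \<phi> :: "nat \<Rightarrow> 'b \<Rightarrow> nat"
  assumes \<phi> [measurable]: "\<And>n. \<phi> n \<in> measurable M (count_space UNIV)"
    and Z: "Z \<in> null_sets M"
    and F: "\<And>t. t \<in> space M \<Longrightarrow> compact (F t) \<and> F t \<noteq> {}"
    and approx: "\<And>n t. t \<in> space M - Z \<Longrightarrow> \<exists>y\<in>F t. p n (y - c (\<phi> n t)) \<le> (1 / 2) ^ n"
  shows "\<exists>f. measurable_by_seminorm p M f \<and> (\<forall>t\<in>space M. f t \<in> F t)"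
proof -
  define J where "J k t = cluster_centre p c (\<lambda>n. \<phi> n t) k" for k t
  have [measurable]: "J k \<in> measurable M (count_space UNIV)" for k
    unfolding J_def by (rule measurable_cluster_centre) (rule \<phi>)
  \<comment> \<open>On \<open>Z\<close> any point of \<open>F t\<close> will do.\<close>
  have "\<exists>z. t \<in> space M \<longrightarrow> z \<in> F t \<and> (t \<notin> Z \<longrightarrow> (\<forall>k. p k (z - c (J k t)) \<le> 2 * (1 / 2) ^ k))" for t
  proof (cases "t \<in> space M - Z")
    case True
    then obtain y where "\<And>n. y n \<in> F t" "\<And>n. p n (y n - c (\<phi> n t)) \<le> (1 / 2) ^ n"
      using approx by metis
    then show ?thesis
      using ex_cluster_limit[of "F t" y c "\<lambda>n. \<phi> n t"] F[of t] True unfolding J_def by blast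
  next
    case False
    then show ?thesis using F[of t] by auto
  qed
  then obtain f where f: "\<And>t. t \<in> space M \<Longrightarrow> f t \<in> F t"
      "\<And>t k. t \<in> space M - Z \<Longrightarrow> p k (f t - c (J k t)) \<le> 2 * (1 / 2) ^ k"
    by (metis DiffE)
  have "seminorm_strongly_measurable (p i) M f" for i
  proof (rule seminorm_strongly_measurableI[OF Z])
    have [measurable]: "(\<lambda>t. p i (c j - c (J k t))) \<in> borel_measurable M" for j k
      by (rule measurable_compose_countable[of "\<lambda>l t. p i (c j - c l)"]) measurable
    show "(\<lambda>t. lim (\<lambda>k. p i (c j - c (J k t)))) \<in> borel_measurable M" for j
      by measurable
    fix t assume t: "t \<in> space M - Z"
    have small: "p i (c (J k t) - f t) \<le> 2 * (1 / 2) ^ k" if "i \<le> k" for k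
      using f(2)[OF t, of k] p_mono[OF that, of "f t - c (J k t)"] p_commute[of i "f t" "c (J k t)"]
      by simp
    have null: "(\<lambda>k. 2 * (1 / 2) ^ k :: real) \<longlonglongrightarrow> 0"
      using tendsto_mult_right_zero[OF LIMSEQ_power_zero[of "1 / 2 :: real"]] by simp
    \<comment> \<open>The error bound is stated in \<open>p k\<close> and dominates
      \<open>p i\<close> only for \<open>k\<close> at least \<open>i\<close>, so the sequence is
      shifted by \<open>i\<close>.\<close>
    show "p i (c j - f t) = lim (\<lambda>k. p i (c j - c (J k t)))" for j
    proof (rule limI[symmetric], rule LIMSEQ_offset[of _ i], rule LIM_zero_cancel)
      show "(\<lambda>k. p i (c j - c (J (k + i) t)) - p i (c j - f t)) \<longlonglongrightarrow> 0"
      proof (rule tendsto_rabs_zero_cancel,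
          rule tendsto_sandwich[OF _ _ tendsto_const LIMSEQ_ignore_initial_segment[OF null, of i]])
        show "\<forall>\<^sub>F k in sequentially. \<bar>p i (c j - c (J (k + i) t)) - p i (c j - f t)\<bar> \<le> 2 * (1 / 2) ^ (k + i)"
        proof (rule always_eventually, rule allI)
          fix k
          show "\<bar>p i (c j - c (J (k + i) t)) - p i (c j - f t)\<bar> \<le> 2 * (1 / 2) ^ (k + i)"
            using small[of "k + i"] p_triangle[of i "c j" "f t" "c (J (k + i) t)"]
              p_triangle[of i "c j" "c (J (k + i) t)" "f t"] p_commute[of i "f t" "c (J (k + i) t)"]
            unfolding abs_le_iff by simp
        qed
      qed simp
    qed
    fix e :: real assume "0 < e"
    then have "\<forall>\<^sub>F k in sequentially. 2 * (1 / 2) ^ k < e"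
      using order_tendstoD(2)[OF null] by blast
    then have "\<forall>\<^sub>F k in sequentially. p i (c (J k t) - f t) < e"
      using eventually_ge_at_top[of i] by eventually_elim (use small in \<open>meson order_le_less_trans\<close>)
    then show "\<exists>j. p i (c j - f t) < e"
      using eventually_happens'[OF sequentially_bot] by blast
  qed
  then show ?thesis
    using f(1) by (auto simp: measurable_by_seminorm_def)
qed

text \<open>For each \<open>n\<close>, exhaust the space by sets on which a single point is near all
  values of \<open>F\<close>; these points are the values of the \<open>n\<close>-th
  approximation.\<close>

lemma property_P_imp_selector:
  fixes F :: "'b \<Rightarrow> 'a set"
  assumes "finite_measure M" and P: "property_P p M F"
    and F: "\<And>t. t \<in> space M \<Longrightarrow> compact (F t) \<and> F t \<noteq> {}"
  shows "\<exists>f. measurable_by_seminorm p M f \<and> (\<forall>t\<in>space M. f t \<in> F t)"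
proof -
  interpret finite_measure M by fact
  define Q where "Q n B \<longleftrightarrow> (\<exists>a. \<forall>t\<in>B. \<exists>y\<in>F t. p n (y - a) \<le> (1 / 2) ^ n)" for n B
  have "\<exists>B :: nat \<Rightarrow> 'b set. (\<forall>m. B m \<in> sets M \<and> Q n (B m)) \<and> space M - (\<Union>m. B m) \<in> null_sets M" for n
  proof (rule countable_exhaustion)
    show "Q n {}" by (simp add: Q_def)
    obtain d where d: "0 < d"
        "\<And>D x y. seminorm_diam p D \<le> d \<Longrightarrow> x \<in> D \<Longrightarrow> y \<in> D \<Longrightarrow> p n (x - y) \<le> (1 / 2) ^ n"
      using small_diam_imp_p_le[of "(1 / 2) ^ n" n] by auto
    fix A assume "A \<in> sets M" "0 < emeasure M A"
    then have "A \<in> pos_sets M" by (simp add: pos_sets_def)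
    then obtain B D where B: "B \<in> pos_sets M" "B \<subseteq> A" "seminorm_diam p D \<le> d"
        "B \<subseteq> lower_inverse (space M) F D"
      using P d(1) unfolding property_P_def by blast
    then have hit: "\<exists>y\<in>F t. y \<in> D" if "t \<in> B" for t
      using that by (auto simp: lower_inverse_def)
    \<comment> \<open>Positive measure makes \<open>B\<close> nonempty, so \<open>D\<close> contains
      a point, which serves as common centre \<open>a\<close>.\<close>
    obtain t where "t \<in> B"
      using B(1) by (fastforce simp: pos_sets_def)
    then obtain a where "a \<in> D" using hit by blast
    then have "\<forall>t\<in>B. \<exists>y\<in>F t. p n (y - a) \<le> (1 / 2) ^ n"
      using hit d(2)[OF B(3)] by blast
    then show "\<exists>B\<in>sets M. B \<subseteq> A \<and> 0 < emeasure M B \<and> Q n B"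
      using B unfolding Q_def pos_sets_def by blast
  qed
  then obtain B :: "nat \<Rightarrow> nat \<Rightarrow> 'b set" where B: "\<And>n m. B n m \<in> sets M" "\<And>n m. Q n (B n m)"
      "\<And>n. space M - (\<Union>m. B n m) \<in> null_sets M"
    by metis
  obtain a where a: "\<And>n m t. t \<in> B n m \<Longrightarrow> \<exists>y\<in>F t. p n (y - a n m) \<le> (1 / 2) ^ n"
    using B(2) unfolding Q_def by metis
  note [measurable] = B(1)
  \<comment> \<open>The pieces may overlap, so the first one is taken; off their union the value is
    irrelevant.\<close>
  define l where "l n t = (LEAST m. t \<in> B n m)" for n t
  have [measurable]: "l n \<in> measurable M (count_space UNIV)" for n
    unfolding l_def by measurable
  \<comment> \<open>One sequence enumerates the values for all \<open>n\<close>, as the cluster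
    construction expects.\<close>
  define c where "c = case_prod a \<circ> prod_decode"
  show ?thesis
  proof (rule ex_measurable_selector_of_approximations[where M = M and c = c
        and Z = "\<Union>n. space M - (\<Union>m. B n m)" and \<phi> = "\<lambda>n t. prod_encode (n, l n t)"])
    show "(\<lambda>t. prod_encode (n, l n t)) \<in> measurable M (count_space UNIV)" for n
      by measurable
    show "(\<Union>n. space M - (\<Union>m. B n m)) \<in> null_sets M"
      using B(3) by (intro null_sets_UN) auto
    fix n t assume "t \<in> space M - (\<Union>n. space M - (\<Union>m. B n m))"
    then obtain m where "t \<in> B n m" by blast
    then have "t \<in> B n (l n t)"
      unfolding l_def by (rule LeastI)
    then show "\<exists>y\<in>F t. p n (y - c (prod_encode (n, l n t))) \<le> (1 / 2) ^ n"
      using a by (simp add: c_def)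
  qed (use F in blast)
qed

section \<open>Separable submultifunctions\<close>

text \<open>\<open>Y\<close> is the closure of the rational span \<open>R\<close> of
  \<open>C\<close>. Since balls of single seminorms form neighbourhood bases, approximation in one
  seminorm at a time describes this closure.\<close>

lemma ex_separable_subspace:
  assumes "countable C"
  shows "\<exists>Y. subspace Y \<and> separable_space (top_of_set Y) \<and>
    (\<forall>x. (\<forall>i e. 0 < e \<longrightarrow> (\<exists>y\<in>C. p i (x - y) < e)) \<longrightarrow> x \<in> Y)"
proof -
  define c where "c = from_nat_into (insert 0 C)"
  \<comment> \<open>Coding combinations by lists makes \<open>R\<close> countable and turns addition
    into concatenation.\<close>
  define g :: "(rat \<times> nat) list \<Rightarrow> 'a" where
    "g l = sum_list (map (\<lambda>(q, n). of_rat q *\<^sub>R c n) l)" for l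
  define R where "R = range g"
  have R_add: "x + y \<in> R" if xy: "x \<in> R" "y \<in> R" for x y
  proof -
    obtain k l where "x = g k" "y = g l"
      using xy unfolding R_def by blast
    then have "x + y = g (k @ l)"
      by (simp add: g_def)
    then show ?thesis by (simp add: R_def)
  qed
  have R_scale: "of_rat q *\<^sub>R x \<in> R" if xy: "x \<in> R" for q x
  proof -
    obtain l where "x = g l"
      using xy unfolding R_def by blast
    moreover have "of_rat q *\<^sub>R g l = g (map (\<lambda>(r, n). (q * r, n)) l)"
      unfolding g_def by (induction l) (auto simp: of_rat_mult scaleR_add_right)
    ultimately show ?thesis by (simp add: R_def)
  qed
  have "0 \<in> R"
    unfolding R_def by (rule range_eqI[of _ _ "[]"]) (simp add: g_def)
  have "C \<subseteq> R"
  proof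
    fix x assume "x \<in> C"
    then obtain n where "c n = x"
      using from_nat_into_surj[of "insert 0 C" x] assms by (auto simp: c_def)
    then have "g [(1, n)] = x" by (simp add: g_def)
    then show "x \<in> R" by (auto simp: R_def)
  qed
  define Y where "Y = {x. \<forall>i e. 0 < e \<longrightarrow> (\<exists>y\<in>R. p i (x - y) < e)}"
  have "R \<subseteq> Y"
  proof
    fix x assume "x \<in> R"
    then have "\<exists>y\<in>R. p i (x - y) < e" if "0 < e" for i e
      using that by (intro bexI[of _ x]) auto
    then show "x \<in> Y" by (simp add: Y_def)
  qed
  have "subspace Y"
  proof (rule subspaceI)
    show "0 \<in> Y" using \<open>R \<subseteq> Y\<close> \<open>0 \<in> R\<close> by blast
    fix x assume x: "x \<in> Y"
    show "x + y \<in> Y" if y: "y \<in> Y" for y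
      unfolding Y_def
    proof (intro CollectI allI impI)
      fix i and e :: real assume "0 < e"
      then have "0 < e / 2" by simp
      then obtain u v where "u \<in> R" "p i (x - u) < e / 2" "v \<in> R" "p i (y - v) < e / 2"
        using x y unfolding Y_def by blast
      then show "\<exists>z\<in>R. p i (x + y - z) < e"
        using p_add[of i "x - u" "y - v"] R_add[of u v]
        by (intro bexI[of _ "u + v"]) (auto simp: algebra_simps)
    qed
    show "a *\<^sub>R x \<in> Y" for a
      unfolding Y_def
    proof (intro CollectI allI impI)
      fix i and e :: real assume e: "0 < e"
      \<comment> \<open>Replacing \<open>a\<close> by a rational \<open>r\<close> within
        \<open>d\<close> costs at most e/2. Only then is \<open>y\<close> chosen, with a radius
        depending on \<open>r\<close>; adding 1 keeps both denominators positive.\<close>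
      define d where "d = (e / 2) / (p i x + 1)"
      have px: "0 < p i x + 1" by (simp add: add_nonneg_pos)
      then have d: "0 < d" using e by (simp add: d_def)
      obtain q where "a - d < of_rat q" "of_rat q < a"
        using of_rat_dense[of "a - d" a] d by auto
      moreover define r :: real where "r = of_rat q"
      ultimately have r: "a - d < r" "r < a" by simp_all
      have "0 < e / (2 * (\<bar>r\<bar> + 1))" using e by (simp add: add_nonneg_pos)
      then obtain y where y: "y \<in> R" "p i (x - y) < e / (2 * (\<bar>r\<bar> + 1))"
        using x unfolding Y_def by blast
      have "p i (a *\<^sub>R x - r *\<^sub>R y) = p i ((a - r) *\<^sub>R x + r *\<^sub>R (x - y))"
        by (simp add: algebra_simps)
      also have "\<dots> \<le> \<bar>a - r\<bar> * p i x + \<bar>r\<bar> * p i (x - y)"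
        using p_add p_scale by metis
      also have "\<dots> < e / 2 + e / 2"
      proof (rule add_le_less_mono)
        have "\<bar>a - r\<bar> * p i x \<le> d * (p i x + 1)"
          using r d by (intro mult_mono) auto
        also have "d * (p i x + 1) = e / 2"
          using px unfolding d_def by (metis less_irrefl nonzero_eq_divide_eq)
        finally show "\<bar>a - r\<bar> * p i x \<le> e / 2" .
        have "\<bar>r\<bar> * p i (x - y) \<le> (\<bar>r\<bar> + 1) * p i (x - y)"
          by (intro mult_right_mono) auto
        also have "\<dots> < e / 2"
          using y(2) by (subst (asm) pos_less_divide_eq) (auto simp: algebra_simps)
        finally show "\<bar>r\<bar> * p i (x - y) < e / 2" .
      qed
      finally show "\<exists>z\<in>R. p i (a *\<^sub>R x - z) < e"
        using R_scale[OF y(1), of q] by (auto simp: r_def)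
    qed
  qed
  moreover have "separable_space (top_of_set Y)"
    unfolding separable_space_def
  proof (intro exI[of _ R] conjI)
    show "countable R" by (simp add: R_def)
    show "R \<subseteq> topspace (top_of_set Y)" using \<open>R \<subseteq> Y\<close> by simp
    have "\<exists>y. y \<in> R \<and> y \<in> T" if T: "x \<in> T" "openin (top_of_set Y) T" for x T
    proof -
      obtain V where V: "open V" "T = Y \<inter> V"
        using T(2) by (auto simp: openin_open)
      then obtain i e where "0 < e" "{y. p i (y - x) < e} \<subseteq> V"
        using open_contains_p_ball[of V x] T(1) by auto
      moreover from this obtain y where "y \<in> R" "p i (x - y) < e"
        using T(1) V(2) unfolding Y_def by blast
      ultimately show ?thesis
        using V(2) \<open>R \<subseteq> Y\<close> p_commute[of i x y] by auto
    qed
    then show "top_of_set Y closure_of R = topspace (top_of_set Y)"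
      by (auto simp: in_closure_of)
  qed
  moreover have "x \<in> Y" if "\<forall>i e. 0 < e \<longrightarrow> (\<exists>y\<in>C. p i (x - y) < e)" for x
    using that \<open>C \<subseteq> R\<close> unfolding Y_def by blast
  ultimately show ?thesis by blast
qed

lemma sets_vimage_strong_limit:
  assumes s: "\<And>i n. simple_function M (s i n)" and Z: "Z \<in> sets M"
    and lim: "\<And>i t. t \<in> space M - Z \<Longrightarrow> (\<lambda>n. p i (s i n t - f t)) \<longlonglongrightarrow> 0"
    and V: "open V"
  shows "{t \<in> space M - Z. f t \<in> V} \<in> sets M"
proof -
  \<comment> \<open>As \<open>V\<close> need not be a countable union of balls, shrink it uniformly instead:
    \<open>f t \<in> V\<close> iff the approximations eventually stay in one \<open>W i k\<close>.\<close>
  define W where "W i k = {x. {y. p i (y - x) < 1 / real (Suc k)} \<subseteq> V}" for i k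
  have [measurable]: "Measurable.pred M (\<lambda>t. s i n t \<in> W i k)" for i n k
    by (rule measurable_compose[OF measurable_simple_function[OF s]]) simp
  have "f t \<in> V \<longleftrightarrow> (\<exists>i k N. \<forall>n\<ge>N. s i n t \<in> W i k)" if t: "t \<in> space M - Z" for t
  proof
    assume "f t \<in> V"
    then obtain i e where e: "0 < e" "{y. p i (y - f t) < e} \<subseteq> V"
      using open_contains_p_ball[OF V] by blast
    \<comment> \<open>One half of \<open>e\<close> is for the ball in \<open>W\<close>, the other
      for the approximation error.\<close>
    obtain k where k: "1 / real (Suc k) < e / 2"
      using e(1) by (meson half_gt_zero nat_approx_posE)
    have "\<forall>\<^sub>F n in sequentially. p i (s i n t - f t) < e / 2"
      by (rule order_tendstoD(2)[OF lim[OF t]]) (use e(1) in simp)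
    then obtain N where N: "\<And>n. N \<le> n \<Longrightarrow> p i (s i n t - f t) < e / 2"
      by (auto simp: eventually_sequentially)
    have "s i n t \<in> W i k" if "N \<le> n" for n
    proof -
      have "p i (y - f t) < e" if "p i (y - s i n t) < 1 / real (Suc k)" for y
        using that k N[OF \<open>N \<le> n\<close>] p_triangle[of i y "f t" "s i n t"] by linarith
      then show ?thesis
        using e(2) unfolding W_def by blast
    qed
    then show "\<exists>i k N. \<forall>n\<ge>N. s i n t \<in> W i k" by blast
  next
    assume "\<exists>i k N. \<forall>n\<ge>N. s i n t \<in> W i k"
    then obtain i k N where N: "\<And>n. N \<le> n \<Longrightarrow> s i n t \<in> W i k" by blast
    have "\<forall>\<^sub>F n in sequentially. p i (s i n t - f t) < 1 / real (Suc k)"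
      by (rule order_tendstoD(2)[OF lim[OF t]]) simp
    then obtain n where "N \<le> n" "p i (s i n t - f t) < 1 / real (Suc k)"
      by (auto simp: eventually_sequentially) (metis nat_le_linear)
    then show "f t \<in> V"
      using N[of n] p_commute[of i "f t" "s i n t"] by (auto simp: W_def)
  qed
  then have "{t \<in> space M - Z. f t \<in> V} =
      {t \<in> space M. \<exists>i k N. \<forall>n\<ge>N. s i n t \<in> W i k} - Z"
    by auto
  also have "\<dots> \<in> sets M"
    using Z by (intro sets.Diff) measurable
  finally show ?thesis .
qed

text \<open>One null set collects the exceptional sets of all seminorms. Off it, \<open>f t\<close>
  is a limit of values of the simple functions, which together form a countable set.\<close>

lemma selector_imp_Effros_submultifunction:
  fixes F :: "'b \<Rightarrow> 'a set"
  assumes f: "measurable_by_seminorm p M f" and F: "\<forall>t\<in>space M. f t \<in> F t"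
  shows "\<exists>\<Omega>\<^sub>0 Y G. \<Omega>\<^sub>0 \<in> null_sets M \<and>
    subspace Y \<and> separable_space (top_of_set Y) \<and>
    (\<forall>t \<in> space M - \<Omega>\<^sub>0. G t \<in> ck Y) \<and>
    effros_measurable M (space M - \<Omega>\<^sub>0) (top_of_set Y) G \<and>
    (\<forall>t \<in> space M - \<Omega>\<^sub>0. G t \<subseteq> F t)"
proof -
  have "\<forall>i. \<exists>(s :: nat \<Rightarrow> 'b \<Rightarrow> 'a) Z. (\<forall>n. simple_function M (s n)) \<and> Z \<in> null_sets M \<and>
      (\<forall>t \<in> space M - Z. (\<lambda>n. p i (s n t - f t)) \<longlonglongrightarrow> 0)"
    using f by (simp add: measurable_by_seminorm_def seminorm_strongly_measurable_def)
  then obtain s :: "nat \<Rightarrow> nat \<Rightarrow> 'b \<Rightarrow> 'a" and Zs where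
    s: "\<And>i n. simple_function M (s i n)" and Zs: "\<And>i. Zs i \<in> null_sets M"
    and lims: "\<And>i t. t \<in> space M - Zs i \<Longrightarrow> (\<lambda>n. p i (s i n t - f t)) \<longlonglongrightarrow> 0"
    by metis
  define Z where "Z = (\<Union>i. Zs i)"
  have Z: "Z \<in> null_sets M"
    unfolding Z_def using Zs by (intro null_sets_UN) auto
  have lim: "(\<lambda>n. p i (s i n t - f t)) \<longlonglongrightarrow> 0" if "t \<in> space M - Z" for i t
    using lims that by (auto simp: Z_def)
  define C where "C = (\<Union>i n. s i n ` space M)"
  have "countable C"
    unfolding C_def using simple_functionD(1)[OF s] by (intro countable_UN) (auto intro: countable_finite)
  then obtain Y where Y: "subspace Y" "separable_space (top_of_set Y)"
      "\<And>x. (\<And>i e. 0 < e \<Longrightarrow> \<exists>y\<in>C. p i (x - y) < e) \<Longrightarrow> x \<in> Y"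
    using ex_separable_subspace[of C] by metis
  have fY: "f t \<in> Y" if t: "t \<in> space M - Z" for t
  proof (rule Y(3))
    fix i and e :: real assume "0 < e"
    then have "\<forall>\<^sub>F n in sequentially. p i (s i n t - f t) < e"
      by (rule order_tendstoD(2)[OF lim[OF t]])
    then obtain n where "p i (s i n t - f t) < e"
      using eventually_happens'[OF sequentially_bot] by blast
    moreover have "s i n t \<in> C"
      using t unfolding C_def by blast
    ultimately show "\<exists>y\<in>C. p i (f t - y) < e"
      using p_commute[of i "f t" "s i n t"] by (intro bexI[of _ "s i n t"]) simp
  qed
  have "effros_measurable M (space M - Z) (top_of_set Y) (\<lambda>t. {f t})"
    unfolding effros_measurable_def
  proof (intro allI impI)
    fix U assume "openin (top_of_set Y) U"
    then obtain V where V: "open V" "U = Y \<inter> V"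
      by (auto simp: openin_open)
    \<comment> \<open>As \<open>f t\<close> lies in \<open>Y\<close>, the relatively open
      \<open>U\<close> may be replaced by \<open>V\<close>.\<close>
    have "lower_inverse (space M - Z) (\<lambda>t. {f t}) U = {t \<in> space M - Z. f t \<in> V}"
      using fY V(2) by (auto simp: lower_inverse_def)
    also have "\<dots> \<in> sets M"
      using sets_vimage_strong_limit[OF s null_setsD2[OF Z] lim V(1)] .
    finally show "lower_inverse (space M - Z) (\<lambda>t. {f t}) U \<in> sets M" .
  qed
  then show ?thesis
    using Z Y(1,2) fY F
    by (intro exI[of _ Z] exI[of _ Y] exI[of _ "\<lambda>t. {f t}"])
      (auto simp: ck_def compactin_subtopology)
qed

text \<open>Small balls around a countable dense subset of \<open>Y\<close> cover \<open>Y\<close>,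
  so the sets \<open>B r\<close> cover \<open>A\<close> up to a null set and one of them is not
  null.\<close>

lemma Effros_submultifunction_imp_property_P:
  fixes F :: "'b \<Rightarrow> 'a set"
  assumes \<Omega>\<^sub>0: "\<Omega>\<^sub>0 \<in> null_sets M" and Y: "separable_space (top_of_set Y)"
    and G: "\<forall>t \<in> space M - \<Omega>\<^sub>0. G t \<in> ck Y"
    and meas: "effros_measurable M (space M - \<Omega>\<^sub>0) (top_of_set Y) G"
    and sub: "\<forall>t \<in> space M - \<Omega>\<^sub>0. G t \<subseteq> F t"
  shows "property_P p M F"
  unfolding property_P_def
proof (intro allI impI ballI)
  fix \<epsilon> :: real and A assume "0 < \<epsilon>" and "A \<in> pos_sets M"
  then have A: "A \<in> sets M" "0 < emeasure M A" by (auto simp: pos_sets_def)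
  obtain i d where d: "0 < d" "\<And>x. seminorm_diam p {y. p i (y - x) < d} \<le> \<epsilon>"
    using small_ball_diam_le[OF \<open>0 < \<epsilon>\<close>] by blast
  obtain R where R: "countable R" "R \<subseteq> Y" "top_of_set Y closure_of R = Y"
    using Y by (auto simp: separable_space_def)
  define D where "D r = {y. p i (y - r) < d}" for r
  \<comment> \<open>Effros measurability speaks of open subsets of \<open>Y\<close>, hence the trace
    of the ball.\<close>
  define B where "B r = A \<inter> lower_inverse (space M - \<Omega>\<^sub>0) G (Y \<inter> D r)" for r
  have B: "B r \<in> sets M" for r
    using meas A(1) openin_open_Int[OF open_p_ball[OF d(1)]]
    unfolding B_def D_def effros_measurable_def by (intro sets.Int) blast+
  have "A - \<Omega>\<^sub>0 \<subseteq> (\<Union>r\<in>R. B r)"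
  proof
    fix t assume t: "t \<in> A - \<Omega>\<^sub>0"
    then have tM: "t \<in> space M - \<Omega>\<^sub>0"
      using sets.sets_into_space[OF A(1)] by blast
    then have "G t \<noteq> {}" "G t \<subseteq> Y"
      using G by (auto simp: ck_def compactin_subtopology)
    then obtain x where x: "x \<in> G t" "x \<in> Y" by blast
    then have "x \<in> top_of_set Y closure_of R" using R(3) by simp
    then have "\<forall>T. x \<in> T \<and> openin (top_of_set Y) T \<longrightarrow> (\<exists>y. y \<in> R \<and> y \<in> T)"
      by (simp add: in_closure_of)
    moreover have "openin (top_of_set Y) (Y \<inter> {y. p i (y - x) < d})"
      using open_p_ball[OF d(1)] by (rule openin_open_Int)
    moreover have "x \<in> Y \<inter> {y. p i (y - x) < d}"
      using x d(1) by simp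
    ultimately have "\<exists>y. y \<in> R \<and> y \<in> Y \<inter> {y. p i (y - x) < d}"
      by (simp only:)
    then obtain r where "r \<in> R" "p i (r - x) < d"
      by blast
    then have "x \<in> D r"
      using p_commute[of i x r] by (simp add: D_def)
    then have "t \<in> B r"
      using t tM x unfolding B_def lower_inverse_def by blast
    then show "t \<in> (\<Union>r\<in>R. B r)"
      using \<open>r \<in> R\<close> by blast
  qed
  moreover have "A \<notin> null_sets M" using A(2) by auto
  moreover have "A - \<Omega>\<^sub>0 \<in> null_sets M \<Longrightarrow> A \<in> null_sets M"
    using null_sets.Un[OF _ \<Omega>\<^sub>0, of "A - \<Omega>\<^sub>0"] null_sets_subset[of _ M A] A(1) by blast
  ultimately have "(\<Union>r\<in>R. B r) \<notin> null_sets M"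
    using null_sets_subset[of _ M "A - \<Omega>\<^sub>0"] A(1) \<Omega>\<^sub>0 by blast
  then obtain r where r: "B r \<notin> null_sets M"
    using null_sets_UN'[OF R(1), of B M] by blast
  show "\<exists>B\<in>pos_sets M. \<exists>D. B \<subseteq> A \<and> seminorm_diam p D \<le> \<epsilon> \<and> B \<subseteq> lower_inverse (space M) F D"
  proof (intro bexI[of _ "B r"] exI[of _ "D r"] conjI)
    show "B r \<in> pos_sets M"
      using B r by (auto simp: pos_sets_def null_sets_def zero_less_iff_neq_zero)
    show "B r \<subseteq> A" by (simp add: B_def)
    show "seminorm_diam p (D r) \<le> \<epsilon>" using d(2) by (simp add: D_def)
    show "B r \<subseteq> lower_inverse (space M) F (D r)"
      using sub unfolding B_def lower_inverse_def by blast
  qed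
qed

end

theorem theorem2p6:
  fixes p :: "nat \<Rightarrow> 'a::{real_vector,topological_space} \<Rightarrow> real"
    and M :: "'b measure"
    and F :: "'b \<Rightarrow> 'a set"
  assumes "frechet_space TYPE('a)"
    and "\<forall>i. seminorm (p i)"
    and "\<forall>i x. p i x \<le> p (Suc i) x"
    and "seminorms_define_topology p"
    and "finite_measure M" and "complete_measure M"
    and "\<forall>t \<in> space M. F t \<in> ck UNIV"
  shows
    "((\<exists>f. measurable_by_seminorm p M f \<and> (\<forall>t \<in> space M. f t \<in> F t)) \<longleftrightarrow> property_P p M F) \<and>
     (property_P p M F \<longleftrightarrow>
        (\<exists>\<Omega>\<^sub>0 Y G. \<Omega>\<^sub>0 \<in> null_sets M \<and>
           subspace Y \<and> separable_space (top_of_set Y) \<and>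
           (\<forall>t \<in> space M - \<Omega>\<^sub>0. G t \<in> ck Y) \<and>
           effros_measurable M (space M - \<Omega>\<^sub>0) (top_of_set Y) G \<and>
           (\<forall>t \<in> space M - \<Omega>\<^sub>0. G t \<subseteq> F t)))"
    (is "(?sel \<longleftrightarrow> ?P) \<and> (?P \<longleftrightarrow> ?sub)")
proof -
  interpret increasing_seminorms p
    using assms(2-4) by unfold_locales auto
  have "compact (F t) \<and> F t \<noteq> {}" if "t \<in> space M" for t
    using assms(7) that by (auto simp: ck_def)
  then have "?P \<Longrightarrow> ?sel"
    using property_P_imp_selector[OF assms(5)] by blast
  moreover have "?sel \<Longrightarrow> ?sub"
    using selector_imp_Effros_submultifunction by blast
  moreover have "?sub \<Longrightarrow> ?P"
    using Effros_submultifunction_imp_property_P by blast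
  ultimately show ?thesis by blast
qed

end
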